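(* Let $f,g$ be two covers with $f\sqsubseteq g$. If $g$ is a minimal cover with respect to the property $|{\rm Hom}(g,f)|=\deg f$, then $g$ is a Galois closure of $f$.
   Context: Let $\mathbf C$ be a category and $\mathbf D$ a full subcategory of $\mathbf C$. For arrows $f,g$ of $\mathbf C$ with ${\rm cod}\,f={\rm cod}\,g$, ${\rm Hom}(g,f)$ denotes the collection of all arrows $h$ of $\mathbf C$ with $g=f\circ h$. Standing assumptions: (G1) every diagram $B\to A\leftarrow C$ in $\mathbf D$ has a pullback in $\mathbf C$. (G2) (I) pushouts exist in $\mathbf D$; (II) every arrow of $\mathbf D$ is epic; (III) every monic arrow of $\mathbf D$ is an isomorphism whose inverse is an arrow of $\mathbf D$. (G3) for every object $U$ of $\mathbf C$ there is a set $\Sigma(U)$ of arrows $i$ of $\mathbf C$ with ${\rm dom}\,i$ in $\mathbf D$ and ${\rm cod}\,i=U$ such that for every arrow $u$ of $\mathbf C$ with ${\rm dom}\,u$ in $\mathbf D$ and ${\rm cod}\,u=U$ there is exactly one $i\in\Sigma(U)$ with ${\rm Hom}(u,i)\neq\emptyset$. (G4) there is a function $\deg$ from the collection of arrows of $\mathbf C$ whose codomain lies in $\mathbf D$ to the positive integers such that (I) $\deg(g\circ f)=\deg g\cdot\deg f$ whenever $f,g,g\circ f$ all lie in this collection; (II) $\deg f=\sum_{i\in\Sigma({\rm dom}\,f)}\deg(f\circ i)$ for every such $f$; (III) if $B\xrightarrow{f}A\xleftarrow{g}C$ is a diagram in $\mathbf D$ with pullback $B\xleftarrow{p}U\xrightarrow{q}C$,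 then $\deg f=\deg q$ and $\deg g=\deg p$. A cover is an arrow of $\mathbf D$. For a cover $f$, ${\rm Aut}(f)$ is the set of isomorphisms in ${\rm Hom}(f,f)$; $f$ is Galois if $|{\rm Aut}(f)|=\deg f$. Write $f\sqsubseteq g$ if ${\rm cod}\,f={\rm cod}\,g$ and ${\rm Hom}(g,f)\neq\emptyset$. A cover $g$ is minimal with respect to a property $P$ if $g$ has $P$ and $g\sqsubseteq h$ for every cover $h$ with $P$ and $h\sqsubseteq g$; it is least with respect to $P$ if it has $P$ and $g\sqsubseteq h$ for every cover $h$ with $P$. A Galois closure of a cover $f$ is a cover $g$ which is minimal with respect to the property "$g$ is Galois and $f\sqsubseteq g$". *)

theory Defs
  imports Main
begin

record ('o, 'a) cat =
  Ob :: "'o set"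
  Ar :: "'a set"
  Dom :: "'a \<Rightarrow> 'o"
  Cod :: "'a \<Rightarrow> 'o"
  Ide :: "'o \<Rightarrow> 'a"
  Comp :: "'a \<Rightarrow> 'a \<Rightarrow> 'a"  (infixl "\<cdot>\<index>" 70)

locale category =
  fixes C :: "('o, 'a) cat" (structure)
  assumes Dom_Ob: "f \<in> Ar C \<Longrightarrow> Dom C f \<in> Ob C"
    and Cod_Ob: "f \<in> Ar C \<Longrightarrow> Cod C f \<in> Ob C"
    and Ide_Ar: "A \<in> Ob C \<Longrightarrow> Ide C A \<in> Ar C"
    and Dom_Ide: "A \<in> Ob C \<Longrightarrow> Dom C (Ide C A) = A"
    and Cod_Ide: "A \<in> Ob C \<Longrightarrow> Cod C (Ide C A) = A"
    and Comp_Ar: "\<lbrakk>f \<in> Ar C; g \<in> Ar C; Cod C f = Dom C g\<rbrakk> \<Longrightarrow> g \<cdot> f \<in> Ar C"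
    and Dom_Comp: "\<lbrakk>f \<in> Ar C; g \<in> Ar C; Cod C f = Dom C g\<rbrakk> \<Longrightarrow> Dom C (g \<cdot> f) = Dom C f"
    and Cod_Comp: "\<lbrakk>f \<in> Ar C; g \<in> Ar C; Cod C f = Dom C g\<rbrakk> \<Longrightarrow> Cod C (g \<cdot> f) = Cod C g"
    and Comp_assoc: "\<lbrakk>f \<in> Ar C; g \<in> Ar C; h \<in> Ar C; Cod C f = Dom C g; Cod C g = Dom C h\<rbrakk>
      \<Longrightarrow> (h \<cdot> g) \<cdot> f = h \<cdot> (g \<cdot> f)"
    and Comp_Ide: "f \<in> Ar C \<Longrightarrow> f \<cdot> Ide C (Dom C f) = f"
    and Ide_Comp: "f \<in> Ar C \<Longrightarrow> Ide C (Cod C f) \<cdot> f = f"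

text \<open>A full subcategory inherits the operations of the ambient category; since these are total
  functions on the underlying types, they are kept literally.\<close>

definition full_subcategory :: "('o, 'a) cat \<Rightarrow> ('o, 'a) cat \<Rightarrow> bool" where
  "full_subcategory D C \<longleftrightarrow> Ob D \<subseteq> Ob C \<and>
     D = C\<lparr>Ob := Ob D, Ar := {f \<in> Ar C. Dom C f \<in> Ob D \<and> Cod C f \<in> Ob D}\<rparr>"

definition monic :: "('o, 'a) cat \<Rightarrow> 'a \<Rightarrow> bool" where
  "monic C m \<longleftrightarrow> m \<in> Ar C \<and>
     (\<forall>a\<in>Ar C. \<forall>b\<in>Ar C. Dom C a = Dom C b \<and> Cod C a = Dom C m \<and> Cod C b = Dom C m \<and>
        m \<cdot>\<^bsub>C\<^esub> a = m \<cdot>\<^bsub>C\<^esub> b \<longrightarrow> a = b)"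

definition epic :: "('o, 'a) cat \<Rightarrow> 'a \<Rightarrow> bool" where
  "epic C e \<longleftrightarrow> e \<in> Ar C \<and>
     (\<forall>a\<in>Ar C. \<forall>b\<in>Ar C. Cod C a = Cod C b \<and> Dom C a = Cod C e \<and> Dom C b = Cod C e \<and>
        a \<cdot>\<^bsub>C\<^esub> e = b \<cdot>\<^bsub>C\<^esub> e \<longrightarrow> a = b)"

definition inverse_arrow :: "('o, 'a) cat \<Rightarrow> 'a \<Rightarrow> 'a \<Rightarrow> bool" where
  "inverse_arrow C f k \<longleftrightarrow> f \<in> Ar C \<and> k \<in> Ar C \<and> Dom C k = Cod C f \<and> Cod C k = Dom C f \<and>
     k \<cdot>\<^bsub>C\<^esub> f = Ide C (Dom C f) \<and> f \<cdot>\<^bsub>C\<^esub> k = Ide C (Cod C f)"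

definition isomorphism :: "('o, 'a) cat \<Rightarrow> 'a \<Rightarrow> bool" where
  "isomorphism C f \<longleftrightarrow> (\<exists>k. inverse_arrow C f k)"

definition is_pullback :: "('o, 'a) cat \<Rightarrow> 'a \<Rightarrow> 'a \<Rightarrow> 'a \<Rightarrow> 'a \<Rightarrow> bool" where
  "is_pullback C f g p q \<longleftrightarrow>
     f \<in> Ar C \<and> g \<in> Ar C \<and> p \<in> Ar C \<and> q \<in> Ar C \<and>
     Cod C f = Cod C g \<and> Dom C p = Dom C q \<and> Cod C p = Dom C f \<and> Cod C q = Dom C g \<and>
     f \<cdot>\<^bsub>C\<^esub> p = g \<cdot>\<^bsub>C\<^esub> q \<and>
     (\<forall>a\<in>Ar C. \<forall>b\<in>Ar C.
        Dom C a = Dom C b \<and> Cod C a = Dom C f \<and> Cod C b = Dom C g \<and> f \<cdot>\<^bsub>C\<^esub> a = g \<cdot>\<^bsub>C\<^esub> b \<longrightarrow>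
        (\<exists>!h. h \<in> Ar C \<and> Dom C h = Dom C a \<and> Cod C h = Dom C p \<and>
           p \<cdot>\<^bsub>C\<^esub> h = a \<and> q \<cdot>\<^bsub>C\<^esub> h = b))"

definition is_pushout :: "('o, 'a) cat \<Rightarrow> 'a \<Rightarrow> 'a \<Rightarrow> 'a \<Rightarrow> 'a \<Rightarrow> bool" where
  "is_pushout C f g p q \<longleftrightarrow>
     f \<in> Ar C \<and> g \<in> Ar C \<and> p \<in> Ar C \<and> q \<in> Ar C \<and>
     Dom C f = Dom C g \<and> Cod C p = Cod C q \<and> Dom C p = Cod C f \<and> Dom C q = Cod C g \<and>
     p \<cdot>\<^bsub>C\<^esub> f = q \<cdot>\<^bsub>C\<^esub> g \<and>
     (\<forall>a\<in>Ar C. \<forall>b\<in>Ar C.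
        Cod C a = Cod C b \<and> Dom C a = Cod C f \<and> Dom C b = Cod C g \<and> a \<cdot>\<^bsub>C\<^esub> f = b \<cdot>\<^bsub>C\<^esub> g \<longrightarrow>
        (\<exists>!h. h \<in> Ar C \<and> Dom C h = Cod C p \<and> Cod C h = Cod C a \<and>
           h \<cdot>\<^bsub>C\<^esub> p = a \<and> h \<cdot>\<^bsub>C\<^esub> q = b))"

definition Homs :: "('o, 'a) cat \<Rightarrow> 'a \<Rightarrow> 'a \<Rightarrow> 'a set" where
  "Homs C g f = {h \<in> Ar C. Cod C h = Dom C f \<and> g = f \<cdot>\<^bsub>C\<^esub> h}"

text \<open>In (G2) it is left open whether ``epic'' and ``monic'' are meant in \<open>C\<close> or in \<open>D\<close>.
  Epic in \<open>C\<close> implies epic in \<open>D\<close>, and monic in \<open>C\<close> implies monic in \<open>D\<close>, so requiring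
  epicness in \<open>D\<close> and inverting only the arrows monic in \<open>C\<close> is implied by (G2) under
  either reading.

  In (G4) the sum of positive integers can only equal the integer \<open>deg f\<close> if its index set is
  finite; the finiteness is spelled out.\<close>

locale galois_setting = category C
  for C :: "('o, 'a) cat" (structure) +
  fixes D :: "('o, 'a) cat"
    and \<Sigma> :: "'o \<Rightarrow> 'a set"
    and deg :: "'a \<Rightarrow> nat"
  assumes full: "full_subcategory D C"
    and G1: "\<lbrakk>f \<in> Ar D; g \<in> Ar D; Cod C f = Cod C g\<rbrakk> \<Longrightarrow> \<exists>p q. is_pullback C f g p q"
    and G2_I: "\<lbrakk>f \<in> Ar D; g \<in> Ar D; Dom C f = Dom C g\<rbrakk> \<Longrightarrow> \<exists>p q. is_pushout D f g p q"
    and G2_II: "e \<in> Ar D \<Longrightarrow> epic D e"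
    and G2_III: "\<lbrakk>m \<in> Ar D; monic C m\<rbrakk> \<Longrightarrow> \<exists>k. inverse_arrow C m k \<and> k \<in> Ar D"
    and G3_Ar: "\<lbrakk>U \<in> Ob C; i \<in> \<Sigma> U\<rbrakk> \<Longrightarrow> i \<in> Ar C \<and> Dom C i \<in> Ob D \<and> Cod C i = U"
    and G3_ex1: "\<lbrakk>U \<in> Ob C; u \<in> Ar C; Dom C u \<in> Ob D; Cod C u = U\<rbrakk>
      \<Longrightarrow> \<exists>!i. i \<in> \<Sigma> U \<and> Homs C u i \<noteq> {}"
    and deg_pos: "\<lbrakk>f \<in> Ar C; Cod C f \<in> Ob D\<rbrakk> \<Longrightarrow> 0 < deg f"
    and G4_I: "\<lbrakk>f \<in> Ar C; g \<in> Ar C; Cod C f = Dom C g; Cod C f \<in> Ob D; Cod C g \<in> Ob D\<rbrakk>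
      \<Longrightarrow> deg (g \<cdot> f) = deg g * deg f"
    and G4_II: "\<lbrakk>f \<in> Ar C; Cod C f \<in> Ob D\<rbrakk>
      \<Longrightarrow> finite (\<Sigma> (Dom C f)) \<and> deg f = (\<Sum>i\<in>\<Sigma> (Dom C f). deg (f \<cdot> i))"
    and G4_III: "\<lbrakk>f \<in> Ar D; g \<in> Ar D; is_pullback C f g p q\<rbrakk> \<Longrightarrow> deg f = deg q \<and> deg g = deg p"

definition cover :: "('o, 'a) cat \<Rightarrow> 'a \<Rightarrow> bool" where
  "cover D f \<longleftrightarrow> f \<in> Ar D"

definition Auts :: "('o, 'a) cat \<Rightarrow> 'a \<Rightarrow> 'a set" where
  "Auts C f = {h \<in> Homs C f f. isomorphism C h}"

text \<open>Since \<open>card\<close> of an infinite set is \<open>0\<close> and degrees of covers are positive, the equations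
  \<open>card S = deg f\<close> below hold only for finite \<open>S\<close>.\<close>

definition is_Galois :: "('o, 'a) cat \<Rightarrow> ('a \<Rightarrow> nat) \<Rightarrow> 'a \<Rightarrow> bool" where
  "is_Galois C deg f \<longleftrightarrow> card (Auts C f) = deg f"

definition below :: "('o, 'a) cat \<Rightarrow> 'a \<Rightarrow> 'a \<Rightarrow> bool"  (infix "\<sqsubseteq>\<index>" 50) where
  "f \<sqsubseteq>\<^bsub>C\<^esub> g \<longleftrightarrow> Cod C f = Cod C g \<and> Homs C g f \<noteq> {}"

definition minimal_cover ::
    "('o, 'a) cat \<Rightarrow> ('o, 'a) cat \<Rightarrow> ('a \<Rightarrow> bool) \<Rightarrow> 'a \<Rightarrow> bool" where
  "minimal_cover C D P g \<longleftrightarrow> cover D g \<and> P g \<and>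
     (\<forall>h. cover D h \<and> P h \<and> h \<sqsubseteq>\<^bsub>C\<^esub> g \<longrightarrow> g \<sqsubseteq>\<^bsub>C\<^esub> h)"

definition is_Galois_closure ::
    "('o, 'a) cat \<Rightarrow> ('o, 'a) cat \<Rightarrow> ('a \<Rightarrow> nat) \<Rightarrow> 'a \<Rightarrow> 'a \<Rightarrow> bool" where
  "is_Galois_closure C D deg f g \<longleftrightarrow>
     minimal_cover C D (\<lambda>h. is_Galois C deg h \<and> f \<sqsubseteq>\<^bsub>C\<^esub> h) g"

end

theory Submission
  imports Defs
begin

text \<open>Sections of a pullback of \<open>f\<close> along \<open>g\<close> correspond to \<open>Hom(g,f)\<close>, and a section is determined
  by the component in \<open>\<Sigma>\<close> through which it factors; hence \<open>|Hom(g,f)| \<le> deg f\<close>. If \<open>h\<close> is Galois and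
  \<open>h = f \<circ> k\<close>, composing with \<open>k\<close> maps \<open>Hom(h,h)\<close> to \<open>Hom(h,f)\<close> with fibres of size at most \<open>deg k\<close>, so
  \<open>|Hom(h,f)| = deg f\<close>, and it only remains to see that a minimal \<open>g\<close> is Galois. Let \<open>i\<close> be a component
  of the pullback of \<open>g\<close> with itself, with projections \<open>a\<close> and \<open>b\<close>. Since \<open>a\<close> and \<open>b\<close> are epic,
  composing with either of them maps \<open>Hom(g,f)\<close> onto \<open>Hom(g \<circ> a,f)\<close>, so all of \<open>Hom(g,f)\<close> factors
  through the pushout of \<open>a\<close> and \<open>b\<close>. By minimality the pushout injections are isomorphisms, so
  \<open>b = \<phi> \<circ> a\<close> with \<open>\<phi> \<in> Aut(g)\<close>. Then \<open>i\<close> is the component of the graph of \<open>\<phi>\<close>; it has degree one,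
  and \<open>\<phi>\<close> determines it. Counting components gives \<open>deg g \<le> |Aut(g)|\<close>.\<close>

context galois_setting
begin

section \<open>Arrows, Hom sets and degrees in the full subcategory\<close>

lemma subcategory_simps [simp]:
  "Dom D = Dom C" "Cod D = Cod C" "Comp D = Comp C" "Ide D = Ide C"
proof -
  have eq: "D = C\<lparr>Ob := Ob D, Ar := {f \<in> Ar C. Dom C f \<in> Ob D \<and> Cod C f \<in> Ob D}\<rparr>"
    using full by (simp add: full_subcategory_def)
  \<comment> \<open>\<open>eq\<close> has \<open>D\<close> on both sides and would loop as a rewrite
    rule, so each selector is applied to it just once.\<close>
  show "Dom D = Dom C" "Cod D = Cod C" "Comp D = Comp C" "Ide D = Ide C"
    using arg_cong[OF eq, of Dom] arg_cong[OF eq, of Cod] arg_cong[OF eq, of Comp]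
      arg_cong[OF eq, of Ide] by simp_all
qed

lemma Ar_sub_iff: "f \<in> Ar D \<longleftrightarrow> f \<in> Ar C \<and> Dom C f \<in> Ob D \<and> Cod C f \<in> Ob D"
proof -
  have eq: "D = C\<lparr>Ob := Ob D, Ar := {f \<in> Ar C. Dom C f \<in> Ob D \<and> Cod C f \<in> Ob D}\<rparr>"
    using full by (simp add: full_subcategory_def)
  show ?thesis
    using arg_cong[OF eq, of Ar] by auto
qed

lemma Ob_sub: "A \<in> Ob D \<Longrightarrow> A \<in> Ob C"
  using full by (auto simp: full_subcategory_def)

lemma Comp_Ar_sub:
  "\<lbrakk>f \<in> Ar D; g \<in> Ar D; Cod C f = Dom C g\<rbrakk> \<Longrightarrow> g \<cdot> f \<in> Ar D"
  by (simp add: Ar_sub_iff Comp_Ar Dom_Comp Cod_Comp)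

lemma Ide_Ar_sub: "A \<in> Ob D \<Longrightarrow> Ide C A \<in> Ar D"
  by (simp add: Ar_sub_iff Ob_sub Ide_Ar Dom_Ide Cod_Ide)

lemma HomsD:
  assumes "h \<in> Homs C g f" "f \<in> Ar C"
  shows "h \<in> Ar C" "Dom C h = Dom C g" "Cod C h = Dom C f" "f \<cdot> h = g" "Cod C g = Cod C f"
  using assms by (auto simp: Homs_def Dom_Comp Cod_Comp)

lemma Homs_sub:
  assumes "h \<in> Homs C g f" "f \<in> Ar D" "g \<in> Ar D"
  shows "h \<in> Ar D"
  using HomsD[OF assms(1)] assms(2,3) by (simp add: Ar_sub_iff)

lemma HomsI: "\<lbrakk>h \<in> Ar C; Cod C h = Dom C f; f \<cdot> h = g\<rbrakk> \<Longrightarrow> h \<in> Homs C g f"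
  by (auto simp: Homs_def)

lemma Homs_Comp:
  assumes "h \<in> Homs C g f" "f \<in> Ar C" "x \<in> Ar C" "Cod C x = Dom C g"
  shows "h \<cdot> x \<in> Homs C (g \<cdot> x) f"
  using HomsD[OF assms(1,2)] assms(2-) by (intro HomsI) (auto simp: Comp_Ar Cod_Comp Comp_assoc[symmetric])

lemma epic_cancel:
  assumes "e \<in> Ar D" "a \<in> Ar D" "b \<in> Ar D" "Cod C a = Cod C b"
    "Dom C a = Cod C e" "Dom C b = Cod C e" "a \<cdot> e = b \<cdot> e"
  shows "a = b"
  using G2_II[OF assms(1)] assms(2-) by (auto simp: epic_def)

lemma deg_pos_sub: "f \<in> Ar D \<Longrightarrow> 0 < deg f"
  by (simp add: Ar_sub_iff deg_pos)

lemma deg_Comp: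
  "\<lbrakk>f \<in> Ar D; g \<in> Ar D; Cod C f = Dom C g\<rbrakk> \<Longrightarrow> deg (g \<cdot> f) = deg g * deg f"
  by (rule G4_I) (auto simp: Ar_sub_iff)

lemma deg_Ide:
  assumes "A \<in> Ob D"
  shows "deg (Ide C A) = 1"
proof -
  let ?e = "Ide C A"
  have e: "?e \<in> Ar D" "Dom C ?e = A" "Cod C ?e = A" "?e \<in> Ar C"
    using assms by (auto simp: Ide_Ar_sub Ob_sub Dom_Ide Cod_Ide Ide_Ar)
  \<comment> \<open>The identity is idempotent, so its degree equals its own square.\<close>
  have "deg ?e * deg ?e = deg ?e"
    using deg_Comp[OF e(1) e(1)] Comp_Ide[OF e(4)] e(2,3) by argo
  then show ?thesis
    using deg_pos_sub[OF e(1)] by simp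
qed

section \<open>Sections as isomorphisms\<close>

lemma inverse_arrow_unique:
  assumes "inverse_arrow C t k" "f \<in> Ar C" "Dom C f = Cod C t" "f \<cdot> t = Ide C (Dom C t)"
  shows "f = k"
proof -
  have k: "t \<in> Ar C" "k \<in> Ar C" "Dom C k = Cod C t" "Cod C k = Dom C t" "t \<cdot> k = Ide C (Cod C t)"
    using assms(1) by (auto simp: inverse_arrow_def)
  have "f = f \<cdot> (t \<cdot> k)"
    using Comp_Ide[OF assms(2)] assms(3) k(5) by simp
  also have "\<dots> = (f \<cdot> t) \<cdot> k"
    using k assms Comp_assoc[of k t f] by simp
  also have "\<dots> = k"
    using Ide_Comp[OF k(2)] k assms by simp
  finally show ?thesis .
qed

text \<open>\<open>t\<close> is split monic, hence monic in \<open>C\<close>, and (G2)(III) inverts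
  it; its left inverse \<open>f\<close> must then be that inverse.\<close>

lemma inverse_arrow_of_section:
  assumes f: "f \<in> Ar D" and t: "t \<in> Ar D"
    and eq: "Cod C t = Dom C f" "f \<cdot> t = Ide C (Dom C t)"
  shows "inverse_arrow C t f"
proof -
  have fC: "f \<in> Ar C" and tC: "t \<in> Ar C"
    using f t by (auto simp: Ar_sub_iff)
  have "monic C t"
    unfolding monic_def
  proof (intro conjI ballI impI tC)
    fix a b
    assume ab: "a \<in> Ar C" "b \<in> Ar C"
      and h: "Dom C a = Dom C b \<and> Cod C a = Dom C t \<and> Cod C b = Dom C t \<and> t \<cdot> a = t \<cdot> b"
    have "a = (f \<cdot> t) \<cdot> a"
      using Ide_Comp[OF ab(1)] h eq by simp
    also have "\<dots> = f \<cdot> (t \<cdot> b)"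
      using ab h fC tC eq(1) Comp_assoc[of a t f] by simp
    also have "\<dots> = (f \<cdot> t) \<cdot> b"
      using ab h fC tC eq(1) Comp_assoc[of b t f] by simp
    also have "\<dots> = b"
      using Ide_Comp[OF ab(2)] h eq by simp
    finally show "a = b" .
  qed
  then obtain k where k: "inverse_arrow C t k"
    using G2_III[OF t] by blast
  moreover have "f = k"
    using inverse_arrow_unique[OF k fC] eq by simp
  ultimately show ?thesis
    by simp
qed

text \<open>By (G4)(I), \<open>deg f * deg t\<close> is the degree of an identity.\<close>

lemma deg_section:
  assumes "f \<in> Ar D" "t \<in> Ar D" "Cod C t = Dom C f" "f \<cdot> t = Ide C (Dom C t)"
  shows "deg f = 1"
  using deg_Comp[OF assms(2,1,3)] assms(2,4) deg_Ide[of "Dom C t"] by (simp add: Ar_sub_iff)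

section \<open>Hom sets bounded by degrees\<close>

text \<open>Every summand in (G4)(II) is a positive integer.\<close>

lemma card_components_le:
  assumes "q \<in> Ar C" "Cod C q \<in> Ob D"
  shows "finite (\<Sigma> (Dom C q))" "card (\<Sigma> (Dom C q)) \<le> deg q"
proof -
  show "finite (\<Sigma> (Dom C q))"
    using G4_II[OF assms] by blast
  have "1 \<le> deg (q \<cdot> i)" if "i \<in> \<Sigma> (Dom C q)" for i
    using G3_Ar[OF Dom_Ob[OF assms(1)] that] assms deg_pos[of "q \<cdot> i"]
    by (simp add: Comp_Ar Cod_Comp)
  then have "(\<Sum>i\<in>\<Sigma> (Dom C q). 1) \<le> (\<Sum>i\<in>\<Sigma> (Dom C q). deg (q \<cdot> i))"
    by (rule sum_mono)
  then show "card (\<Sigma> (Dom C q)) \<le> deg q"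
    using G4_II[OF assms] by simp
qed

lemma finite_card_Homs_le:
  assumes f: "f \<in> Ar D" and g: "g \<in> Ar D"
  shows "finite (Homs C g f) \<and> card (Homs C g f) \<le> deg f"
proof (cases "Cod C f = Cod C g")
  case False
  then have "Homs C g f = {}"
    using HomsD(5)[of _ g f] f by (fastforce simp: Ar_sub_iff)
  then show ?thesis
    by simp
next
  case True
  obtain p q where pb: "is_pullback C f g p q"
    using G1[OF f g True] by blast
  have pq: "p \<in> Ar C" "q \<in> Ar C" "Dom C p = Dom C q" "Cod C q = Dom C g" "Cod C p = Dom C f"
    using pb by (auto simp: is_pullback_def)
  have gC: "g \<in> Ar C" "Dom C g \<in> Ob D" and fC: "f \<in> Ar C" "Dom C f \<in> Ob D"
    using f g by (auto simp: Ar_sub_iff)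
  let ?U = "Dom C q" and ?e = "Ide C (Dom C g)"
  have U: "?U \<in> Ob C"
    using pq by (simp add: Dom_Ob)
  have e: "?e \<in> Ar C" "Dom C ?e = Dom C g" "Cod C ?e = Dom C g"
    using gC Ob_sub by (auto simp: Ide_Ar Dom_Ide Cod_Ide)
  have ex: "\<exists>i. i \<in> \<Sigma> ?U \<and> (\<exists>t\<in>Ar D. Dom C t = Dom C g \<and> Cod C t = Dom C i \<and>
      h = (p \<cdot> i) \<cdot> t \<and> (q \<cdot> i) \<cdot> t = ?e)" if h: "h \<in> Homs C g f" for h
  proof -
    note h' = HomsD[OF h fC(1)]
    \<comment> \<open>The pair of \<open>h\<close> and \<open>?e\<close> induces a section
      \<open>s\<close> of \<open>q\<close>; since its domain lies in \<open>D\<close>, (G3) factors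
      it as \<open>t\<close> followed by a component \<open>i\<close>.\<close>
    have "f \<cdot> h = g \<cdot> ?e"
      using h' gC Comp_Ide by simp
    then obtain s where s: "s \<in> Ar C" "Dom C s = Dom C g" "Cod C s = ?U" "p \<cdot> s = h" "q \<cdot> s = ?e"
      using pb h' e pq unfolding is_pullback_def by metis
    obtain i where i: "i \<in> \<Sigma> ?U" "Homs C s i \<noteq> {}"
      using G3_ex1[OF U s(1)] s gC by auto
    have iC: "i \<in> Ar C" "Dom C i \<in> Ob D" "Cod C i = ?U"
      using G3_Ar[OF U i(1)] by auto
    obtain t where "t \<in> Homs C s i"
      using i by blast
    note t = HomsD[OF this iC(1)]
    have "t \<in> Ar D"
      using t s iC gC by (simp add: Ar_sub_iff)
    moreover have "h = (p \<cdot> i) \<cdot> t" "(q \<cdot> i) \<cdot> t = ?e"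
      using t s iC pq by (simp_all add: Comp_assoc)
    ultimately show ?thesis
      using i t s by metis
  qed
  obtain I where I: "\<And>h. h \<in> Homs C g f \<Longrightarrow> I h \<in> \<Sigma> ?U \<and> (\<exists>t\<in>Ar D. Dom C t = Dom C g \<and>
      Cod C t = Dom C (I h) \<and> h = (p \<cdot> I h) \<cdot> t \<and> (q \<cdot> I h) \<cdot> t = ?e)"
    using ex by metis
  have "inj_on I (Homs C g f)"
  proof (rule inj_onI)
    fix h k
    assume h: "h \<in> Homs C g f" and k: "k \<in> Homs C g f" and eq: "I h = I k"
    obtain t where t: "t \<in> Ar D" "Dom C t = Dom C g" "Cod C t = Dom C (I h)"
      "h = (p \<cdot> I h) \<cdot> t" "(q \<cdot> I h) \<cdot> t = ?e"
      using I[OF h] by blast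
    obtain u where u: "u \<in> Ar D" "Dom C u = Dom C g" "Cod C u = Dom C (I h)"
      "k = (p \<cdot> I h) \<cdot> u" "(q \<cdot> I h) \<cdot> u = ?e"
      using I[OF k] eq by metis
    have "I h \<in> Ar C" "Dom C (I h) \<in> Ob D" "Cod C (I h) = ?U"
      using I[OF h] G3_Ar[OF U] by auto
    then have q: "q \<cdot> I h \<in> Ar D" "Dom C (q \<cdot> I h) = Dom C (I h)" "Cod C (q \<cdot> I h) = Dom C g"
      using pq gC by (auto simp: Ar_sub_iff Comp_Ar Dom_Comp Cod_Comp)
    \<comment> \<open>Both lifts are sections of the same arrow of \<open>D\<close>, so both are
      inverse to it.\<close>
    have "inverse_arrow C t (q \<cdot> I h)" "inverse_arrow C u (q \<cdot> I h)"
      using q t u by (auto intro!: inverse_arrow_of_section)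
    then have "t = u"
      using inverse_arrow_unique[of "q \<cdot> I h" u t] by (auto simp: inverse_arrow_def)
    then show "h = k"
      using t u by metis
  qed
  moreover have "I ` Homs C g f \<subseteq> \<Sigma> ?U"
    using I by blast
  moreover have "finite (\<Sigma> ?U)" "card (\<Sigma> ?U) \<le> deg f"
    using card_components_le[OF pq(2)] pq gC G4_III[OF f g pb] by auto
  ultimately show ?thesis
    by (meson card_inj_on_le inj_on_finite le_trans)
qed

text \<open>Composition with an endomorphism \<open>x\<close> on the right is injective on the finite set \<open>Hom(g,g)\<close>,
  hence hits the identity.\<close>

lemma Homs_self_iso:
  assumes g: "g \<in> Ar D" and x: "x \<in> Homs C g g"
  shows "\<exists>y \<in> Homs C g g. inverse_arrow C x y"
proof -
  have gC: "g \<in> Ar C" "Dom C g \<in> Ob D"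
    using g by (auto simp: Ar_sub_iff)
  note H = HomsD[OF _ gC(1)] Homs_sub[OF _ g g]
  note xD = H[OF x]
  have "inj_on (\<lambda>y. y \<cdot> x) (Homs C g g)"
  proof (rule inj_onI)
    fix y z
    assume y: "y \<in> Homs C g g" and z: "z \<in> Homs C g g" and eq: "y \<cdot> x = z \<cdot> x"
    show "y = z"
      using epic_cancel[OF xD(6) H(6)[OF y] H(6)[OF z]] H[OF y] H[OF z] xD eq by simp
  qed
  moreover have "(\<lambda>y. y \<cdot> x) ` Homs C g g \<subseteq> Homs C g g"
    using Homs_Comp[OF _ gC(1) xD(1,3)] xD(4) by auto
  ultimately have "(\<lambda>y. y \<cdot> x) ` Homs C g g = Homs C g g"
    using finite_card_Homs_le[OF g g] by (simp add: endo_inj_surj)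
  moreover have "Ide C (Dom C g) \<in> Homs C g g"
    using gC Ob_sub by (intro HomsI) (auto simp: Ide_Ar Cod_Ide Comp_Ide)
  ultimately obtain y where y: "y \<in> Homs C g g" "y \<cdot> x = Ide C (Dom C g)"
    by (metis imageE)
  \<comment> \<open>A left inverse \<open>y\<close> suffices: \<open>x\<close> is then a section of
    \<open>y\<close> within \<open>D\<close>.\<close>
  then have "inverse_arrow C x y"
    using H[OF y(1)] xD by (intro inverse_arrow_of_section) auto
  then show ?thesis
    using y by blast
qed

text \<open>With this, being Galois means that Hom(g,g) attains the bound
  \<open>deg g\<close>.\<close>

lemma Auts_eq_Homs:
  assumes "g \<in> Ar D"
  shows "Auts C g = Homs C g g"
  using Homs_self_iso[OF assms] by (auto simp: Auts_def isomorphism_def)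

section \<open>Galois covers attain the bound\<close>

lemma card_Homs_Galois:
  assumes f: "f \<in> Ar D" and h: "h \<in> Ar D" and gal: "is_Galois C deg h" and le: "f \<sqsubseteq> h"
  shows "card (Homs C h f) = deg f"
proof -
  obtain k where k: "k \<in> Homs C h f"
    using le by (auto simp: below_def)
  have fC: "f \<in> Ar C" and hC: "h \<in> Ar C"
    using f h by (auto simp: Ar_sub_iff)
  note kD = HomsD[OF k fC] Homs_sub[OF k f h]
  note H = HomsD[OF _ hC] Homs_sub[OF _ h h]
  let ?S = "Homs C h h"
  let ?K = "\<lambda>a. k \<cdot> a"
  have fin: "finite ?S"
    using finite_card_Homs_le[OF h h] by simp
  have im: "?K ` ?S \<subseteq> Homs C h f"
    using Homs_Comp[OF k fC] H by fastforce
  have fibre: "card {a \<in> ?S. k \<cdot> a = y} \<le> deg k" if y: "y \<in> ?K ` ?S" for y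
  proof -
    have yD: "y \<in> Ar D"
      using y im Homs_sub[OF _ f h] by blast
    \<comment> \<open>Each \<open>a\<close> in the fibre is itself an element of Hom(y,k), whose
      size is at most \<open>deg k\<close>.\<close>
    have "{a \<in> ?S. k \<cdot> a = y} \<subseteq> Homs C y k"
      using H kD by (auto intro!: HomsI)
    then show ?thesis
      using finite_card_Homs_le[OF kD(6) yD] card_mono le_trans by blast
  qed
  \<comment> \<open>The Galois condition counts Hom(h,h) as \<open>deg h\<close>; splitting it into
    fibres bounds it by the image size times \<open>deg k\<close>, which then cancels.\<close>
  have "deg f * deg k = card ?S"
    using gal deg_Comp[OF kD(6) f] kD Auts_eq_Homs[OF h] by (simp add: is_Galois_def)
  also have "\<dots> = (\<Sum>y\<in>?K ` ?S. card {a \<in> ?S. k \<cdot> a = y})"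
    using sum.image_gen[OF fin, of "\<lambda>_. 1::nat" ?K] by simp
  also have "\<dots> \<le> card (?K ` ?S) * deg k"
    using sum_mono[OF fibre] by simp
  finally have "deg f \<le> card (?K ` ?S)"
    using deg_pos_sub[OF kD(6)] by simp
  also have "\<dots> \<le> card (Homs C h f)"
    using im finite_card_Homs_le[OF f h] card_mono by blast
  finally show ?thesis
    using finite_card_Homs_le[OF f h] by simp
qed

section \<open>Minimal covers\<close>

text \<open>\<open>a\<close> is epic, so precomposition is injective; its source has
  \<open>deg f\<close> elements and its target at most that many.\<close>

lemma Homs_precomp_image:
  assumes f: "f \<in> Ar D" and g: "g \<in> Ar D" and card: "card (Homs C g f) = deg f"
    and a: "a \<in> Ar D" "Cod C a = Dom C g"
  shows "(\<lambda>h. h \<cdot> a) ` Homs C g f = Homs C (g \<cdot> a) f"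
proof (rule card_seteq)
  have fC: "f \<in> Ar C" and aC: "a \<in> Ar C"
    using f a by (auto simp: Ar_sub_iff)
  have ga: "g \<cdot> a \<in> Ar D"
    using a g by (simp add: Comp_Ar_sub)
  note H = HomsD[OF _ fC] Homs_sub[OF _ f g]
  show "finite (Homs C (g \<cdot> a) f)"
    using finite_card_Homs_le[OF f ga] by simp
  show "(\<lambda>h. h \<cdot> a) ` Homs C g f \<subseteq> Homs C (g \<cdot> a) f"
    using Homs_Comp[OF _ fC aC] a by auto
  have "inj_on (\<lambda>h. h \<cdot> a) (Homs C g f)"
    by (rule inj_onI, rule epic_cancel[OF a(1)]) (use H a in auto)
  then show "card (Homs C (g \<cdot> a) f) \<le> card ((\<lambda>h. h \<cdot> a) ` Homs C g f)"
    using finite_card_Homs_le[OF f ga] by (simp add: card_image card)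
qed

lemma minimal_projections_conjugate:
  assumes f: "f \<in> Ar D" and g: "g \<in> Ar D"
    and min: "minimal_cover C D (\<lambda>h. card (Homs C h f) = deg f) g"
    and a: "a \<in> Ar D" "Cod C a = Dom C g" and b: "b \<in> Ar D" "Cod C b = Dom C g"
    and eq: "g \<cdot> a = g \<cdot> b"
  shows "\<exists>\<phi> \<in> Homs C g g. b = \<phi> \<cdot> a"
proof -
  have card: "card (Homs C g f) = deg f"
    using min by (simp add: minimal_cover_def)
  have C: "f \<in> Ar C" "g \<in> Ar C" "a \<in> Ar C" "b \<in> Ar C"
    using f g a b by (auto simp: Ar_sub_iff)
  have dom: "Dom C a = Dom C b"
    using eq C a b Dom_Comp by metis
  obtain u v where po: "is_pushout D a b u v"
    using G2_I[OF a(1) b(1)] dom by auto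
  have uv: "u \<in> Ar D" "v \<in> Ar D" "Dom C u = Dom C g" "Dom C v = Dom C g" "Cod C u = Cod C v"
    "u \<cdot> a = v \<cdot> b"
    using po a b by (auto simp: is_pushout_def)
  have uvC: "u \<in> Ar C" "v \<in> Ar C"
    using uv by (auto simp: Ar_sub_iff)
  have univ: "\<exists>h. h \<in> Ar D \<and> Dom C h = Cod C u \<and> Cod C h = Cod C x \<and> h \<cdot> u = x \<and> h \<cdot> v = y"
    if "x \<in> Ar D" "y \<in> Ar D" "Cod C x = Cod C y" "Dom C x = Dom C g" "Dom C y = Dom C g"
      "x \<cdot> a = y \<cdot> b" for x y
    using po that a b unfolding is_pushout_def subcategory_simps by metis
  \<comment> \<open>\<open>g'\<close> is \<open>g\<close> descended to the pushout object; the aim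
    is to show that it has the counting property too.\<close>
  obtain g' where g': "g' \<in> Ar D" "Dom C g' = Cod C u" "Cod C g' = Cod C g" "g' \<cdot> u = g" "g' \<cdot> v = g"
    using univ[OF g g] eq by auto
  have g'C: "g' \<in> Ar C"
    using g' by (simp add: Ar_sub_iff)
  have fact: "\<exists>h \<in> Homs C g' f. h \<cdot> u = x" if x: "x \<in> Homs C g f" for x
  proof -
    note xD = HomsD[OF x C(1)] Homs_sub[OF x f g]
    have "x \<cdot> a \<in> Homs C (g \<cdot> b) f"
      using Homs_Comp[OF x C(1,3) a(2)] eq by simp
    \<comment> \<open>Surjectivity along \<open>b\<close> supplies a partner \<open>y\<close>, so
      that \<open>x\<close> and \<open>y\<close> glue on the pushout.\<close>
    then obtain y where y: "y \<in> Homs C g f" "x \<cdot> a = y \<cdot> b"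
      using Homs_precomp_image[OF f g card b] by auto
    note yD = HomsD[OF y(1) C(1)] Homs_sub[OF y(1) f g]
    obtain h where h: "h \<in> Ar D" "Dom C h = Cod C u" "Cod C h = Cod C x" "h \<cdot> u = x"
      using univ[OF xD(6) yD(6)] xD yD y by auto
    have hC: "h \<in> Ar C"
      using h by (simp add: Ar_sub_iff)
    \<comment> \<open>It is enough to compare after the epic \<open>u\<close>, where both sides
      become \<open>g\<close>.\<close>
    have "f \<cdot> h = g'"
    proof (rule epic_cancel[OF uv(1)])
      show "f \<cdot> h \<in> Ar D"
        using h f xD by (simp add: Comp_Ar_sub)
      show "(f \<cdot> h) \<cdot> u = g' \<cdot> u"
        using h hC uvC C xD g' by (simp add: Comp_assoc)
    qed (use h hC xD C g' in \<open>auto simp: Dom_Comp Cod_Comp\<close>)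
    then show ?thesis
      using h hC xD by (intro bexI[of _ h] HomsI) auto
  qed
  then have "Homs C g f \<subseteq> (\<lambda>h. h \<cdot> u) ` Homs C g' f"
    by blast
  then have "deg f \<le> card (Homs C g' f)"
    using finite_card_Homs_le[OF f g'(1)] surj_card_le card by metis
  then have "card (Homs C g' f) = deg f"
    using finite_card_Homs_le[OF f g'(1)] by simp
  moreover have "g' \<sqsubseteq> g"
    unfolding below_def using g' uv uvC by (auto simp: Homs_def)
  ultimately have "g \<sqsubseteq> g'"
    using min g'(1) by (auto simp: minimal_cover_def cover_def)
  then obtain w where w: "w \<in> Homs C g' g"
    by (auto simp: below_def)
  note wD = HomsD[OF w C(2)] Homs_sub[OF w g g'(1)]
  \<comment> \<open>Both composites are automorphisms of \<open>g\<close>; the witness will be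
    \<open>w \<cdot> u\<close> followed by the inverse of \<open>w \<cdot> v\<close>.\<close>
  have wuv: "w \<cdot> u \<in> Homs C g g" "w \<cdot> v \<in> Homs C g g"
    using Homs_Comp[OF w C(2) uvC(1)] Homs_Comp[OF w C(2) uvC(2)] g' uv by auto
  obtain z where z: "z \<in> Homs C g g" "inverse_arrow C (w \<cdot> v) z"
    using Homs_self_iso[OF g wuv(2)] by blast
  note zD = HomsD[OF z(1) C(2)]
  have wu: "w \<cdot> u \<in> Ar C" "Cod C (w \<cdot> u) = Dom C g"
    using HomsD[OF wuv(1) C(2)] by auto
  show ?thesis
  proof
    show "z \<cdot> (w \<cdot> u) \<in> Homs C g g"
      using Homs_Comp[OF z(1) C(2) wu] HomsD(4)[OF wuv(1) C(2)] by simp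
    have "(z \<cdot> (w \<cdot> u)) \<cdot> a = z \<cdot> (w \<cdot> (u \<cdot> a))"
      using zD wD wu uv uvC C a g' by (simp add: Comp_assoc Dom_Comp)
    also have "\<dots> = (z \<cdot> (w \<cdot> v)) \<cdot> b"
      using zD wD wu uv uvC C b g' HomsD[OF wuv(2) C(2)] by (simp add: Comp_assoc)
    also have "\<dots> = b"
      using z(2) Ide_Comp[OF C(4)] b HomsD[OF wuv(2) C(2)] by (simp add: inverse_arrow_def)
    finally show "b = (z \<cdot> (w \<cdot> u)) \<cdot> a"
      by simp
  qed
qed

lemma minimal_is_Galois:
  assumes f: "f \<in> Ar D" and g: "g \<in> Ar D"
    and min: "minimal_cover C D (\<lambda>h. card (Homs C h f) = deg f) g"
  shows "is_Galois C deg g"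
proof -
  obtain p q where pb: "is_pullback C g g p q"
    using G1[OF g g] by blast
  have pq: "p \<in> Ar C" "q \<in> Ar C" "Dom C q = Dom C p" "Cod C q = Dom C g" "Cod C p = Dom C g"
    "g \<cdot> p = g \<cdot> q"
    using pb by (auto simp: is_pullback_def)
  have gC: "g \<in> Ar C" "Dom C g \<in> Ob D"
    using g by (auto simp: Ar_sub_iff)
  let ?U = "Dom C p" and ?e = "Ide C (Dom C g)"
  have U: "?U \<in> Ob C"
    using pq by (simp add: Dom_Ob)
  have e: "?e \<in> Ar C" "Dom C ?e = Dom C g" "Cod C ?e = Dom C g"
    using gC Ob_sub by (auto simp: Ide_Ar Dom_Ide Cod_Ide)
  have graph: "\<exists>s. s \<in> Ar C \<and> Dom C s = Dom C g \<and> Cod C s = ?U \<and> p \<cdot> s = ?e \<and> q \<cdot> s = \<phi>"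
    if "\<phi> \<in> Homs C g g" for \<phi>
    using pb e pq HomsD[OF that gC(1)] Comp_Ide[OF gC(1)] unfolding is_pullback_def by metis
  \<comment> \<open>\<open>s \<phi>\<close> is the graph of \<open>\<phi>\<close>, as an arrow into
    the pullback.\<close>
  obtain s where s: "\<And>\<phi>. \<phi> \<in> Homs C g g \<Longrightarrow>
      s \<phi> \<in> Ar C \<and> Dom C (s \<phi>) = Dom C g \<and> Cod C (s \<phi>) = ?U \<and> p \<cdot> s \<phi> = ?e \<and> q \<cdot> s \<phi> = \<phi>"
    using graph by metis
  have comp: "deg (p \<cdot> i) = 1 \<and> (\<exists>\<phi> \<in> Homs C g g. Homs C (s \<phi>) i \<noteq> {})" if i: "i \<in> \<Sigma> ?U" for i
  proof -
    have iC: "i \<in> Ar C" "Dom C i \<in> Ob D" "Cod C i = ?U"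
      using G3_Ar[OF U i] by auto
    let ?a = "p \<cdot> i" and ?b = "q \<cdot> i"
    have aC: "?a \<in> Ar C" "Dom C ?a = Dom C i" "Cod C ?a = Dom C g"
      and bC: "?b \<in> Ar C" "Dom C ?b = Dom C i" "Cod C ?b = Dom C g"
      using iC pq by (auto simp: Comp_Ar Dom_Comp Cod_Comp)
    have aD: "?a \<in> Ar D" and bD: "?b \<in> Ar D"
      using aC bC iC gC by (auto simp: Ar_sub_iff)
    have gab: "g \<cdot> ?a = g \<cdot> ?b"
      using pq iC gC by (simp add: Comp_assoc[symmetric])
    obtain \<phi> where \<phi>: "\<phi> \<in> Homs C g g" "?b = \<phi> \<cdot> ?a"
      using minimal_projections_conjugate[OF f g min aD aC(3) bD bC(3) gab] by blast
    have S: "s \<phi> \<in> Ar C" "Dom C (s \<phi>) = Dom C g" "Cod C (s \<phi>) = ?U" "p \<cdot> s \<phi> = ?e" "q \<cdot> s \<phi> = \<phi>"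
      using s[OF \<phi>(1)] by auto
    have sa: "s \<phi> \<cdot> ?a \<in> Ar C" "Dom C (s \<phi> \<cdot> ?a) = Dom C i" "Cod C (s \<phi> \<cdot> ?a) = ?U"
      using S aC by (auto simp: Comp_Ar Dom_Comp Cod_Comp)
    have "p \<cdot> (s \<phi> \<cdot> ?a) = ?a" "q \<cdot> (s \<phi> \<cdot> ?a) = ?b"
      using S aC pq \<phi>(2) Ide_Comp[OF aC(1)]
      by (simp_all add: Comp_assoc[symmetric, where f = ?a])
    \<comment> \<open>The two arrows have the same projections to both factors of the
      pullback.\<close>
    then have i_eq: "s \<phi> \<cdot> ?a = i"
      using pb aC bC gab iC sa unfolding is_pullback_def by metis
    obtain j where j: "j \<in> \<Sigma> ?U" "Homs C (s \<phi>) j \<noteq> {}"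
      using G3_ex1[OF U S(1)] S gC by auto
    have jC: "j \<in> Ar C"
      using G3_Ar[OF U j(1)] by auto
    obtain t where t: "t \<in> Homs C (s \<phi>) j"
      using j by blast
    have "t \<cdot> ?a \<in> Homs C i j"
      using Homs_Comp[OF t jC aC(1)] aC S i_eq by simp
    moreover have "Ide C (Dom C i) \<in> Homs C i i"
      using iC Ob_sub by (intro HomsI) (auto simp: Ide_Ar Cod_Ide Comp_Ide)
    \<comment> \<open>\<open>i\<close> factors through \<open>j\<close> and through itself, so (G3)
      identifies them: \<open>i\<close> is the component of the graph.\<close>
    ultimately have "j = i"
      using G3_ex1[OF U iC] i j(1) by blast
    then have t: "t \<in> Homs C (s \<phi>) i"
      using t by simp
    note tD = HomsD[OF t iC(1)]
    have "t \<in> Ar D"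
      using tD S iC gC by (simp add: Ar_sub_iff)
    \<comment> \<open>So \<open>t\<close> is a section of \<open>?a\<close>, which forces degree
      one.\<close>
    moreover have "?a \<cdot> t = ?e"
      using tD S iC pq by (simp add: Comp_assoc)
    ultimately have "deg ?a = 1"
      using aD aC tD S by (intro deg_section[of _ t]) auto
    then show ?thesis
      using \<phi> t by blast
  qed
  obtain F where F: "\<And>i. i \<in> \<Sigma> ?U \<Longrightarrow> F i \<in> Homs C g g \<and> Homs C (s (F i)) i \<noteq> {}"
    using comp by metis
  have "inj_on F (\<Sigma> ?U)"
  proof (rule inj_onI)
    fix i j
    assume "i \<in> \<Sigma> ?U" "j \<in> \<Sigma> ?U" "F i = F j"
    \<comment> \<open>The graph of \<open>F i\<close> factors through exactly one component.\<close>
    then show "i = j"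
      using F[of i] F[of j] s[of "F i"] G3_ex1[OF U, of "s (F i)"] gC by auto
  qed
  moreover have "F ` \<Sigma> ?U \<subseteq> Homs C g g"
    using F by blast
  ultimately have "card (\<Sigma> ?U) \<le> card (Homs C g g)"
    using finite_card_Homs_le[OF g g] card_inj_on_le by blast
  \<comment> \<open>All summands in (G4)(II) are one, so \<open>deg p\<close> counts the
    components.\<close>
  moreover have "deg p = card (\<Sigma> ?U)"
    using G4_II[OF pq(1)] pq gC comp by simp
  moreover have "deg p = deg g"
    using G4_III[OF g g pb] by simp
  \<comment> \<open>The reverse inequality is the general bound on Hom(g,g).\<close>
  ultimately show ?thesis
    using finite_card_Homs_le[OF g g] Auts_eq_Homs[OF g] by (simp add: is_Galois_def)
qed

end

theorem theorem3p18:
  fixes C D :: "('o, 'a) cat" and \<Sigma> :: "'o \<Rightarrow> 'a set" and deg :: "'a \<Rightarrow> nat" and f g :: 'a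
  assumes "galois_setting C D \<Sigma> deg"
    and "cover D f" and "cover D g"
    and "f \<sqsubseteq>\<^bsub>C\<^esub> g"
    and "minimal_cover C D (\<lambda>h. card (Homs C h f) = deg f) g"
  shows "is_Galois_closure C D deg f g"
proof -
  interpret galois_setting C D \<Sigma> deg by fact
  have f: "f \<in> Ar D" and g: "g \<in> Ar D"
    using assms(2,3) by (simp_all add: cover_def)
  show ?thesis
    unfolding is_Galois_closure_def minimal_cover_def
  proof (intro conjI allI impI)
    show "cover D g" "f \<sqsubseteq>\<^bsub>C\<^esub> g"
      by fact+
    show "is_Galois C deg g"
      using minimal_is_Galois[OF f g assms(5)] .
  next
    fix h
    assume h: "cover D h \<and> (is_Galois C deg h \<and> f \<sqsubseteq>\<^bsub>C\<^esub> h) \<and> h \<sqsubseteq>\<^bsub>C\<^esub> g"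
    \<comment> \<open>A Galois cover above \<open>f\<close> has the counting property, so the
      minimality of \<open>g\<close> for that property applies to \<open>h\<close>.\<close>
    then have "card (Homs C h f) = deg f"
      by (intro card_Homs_Galois[OF f]) (simp_all add: cover_def)
    with h show "g \<sqsubseteq>\<^bsub>C\<^esub> h"
      using assms(5) unfolding minimal_cover_def by blast
  qed
qed

end
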